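(* Let $M(p)=\#\{q_p(u):\ 0\le u\le p-1\}$ be the image size of $u\mapsto q_p(u)$ on $\{0,\ldots,p-1\}$. Then $M(p)\ge (1+o(1))\,\frac{p}{(\log p)^2}$ as $p\to\infty$ over primes $p$.
   Context: For a prime $p$ and an integer $u$ with $\gcd(u,p)=1$, the Fermat quotient $q_p(u)$ is the unique integer with $q_p(u)\equiv (u^{p-1}-1)/p \pmod p$ and $0\le q_p(u)\le p-1$; also $q_p(kp)=0$ for all $k\in\mathbb{Z}$. *)

theory Defs
  imports "HOL-Computational_Algebra.Primes" Complex_Main
begin

definition fermat_quotient :: "nat \<Rightarrow> int \<Rightarrow> int" where
  "fermat_quotient p u =
     (if int p dvd u then 0 else ((u ^ (p - 1) - 1) div int p) mod int p)"

definition M :: "nat \<Rightarrow> nat" where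
  "M p = card (fermat_quotient p ` {0..int p - 1})"

end

theory Submission
  imports Defs
    "HOL-Number_Theory.Residues"
    "HOL-Number_Theory.Modular_Inverse"
    "HOL-Analysis.Harmonic_Numbers"
    "HOL-Real_Asymp.Real_Asymp"
begin

text \<open>
  Two integers prime to \<open>p\<close> have the same Fermat quotient iff their ratio is a \<open>(p - 1)\<close>-st root of
  unity modulo \<open>p\<^sup>2\<close>. Such a root is determined by its residue modulo \<open>p\<close>, and for
  \<open>0 < u, v < p\<close> the residue of \<open>u / v\<close> modulo \<open>p\<^sup>2\<close> determines the rational number \<open>u / v\<close>. Hence
  the colliding pairs \<open>(u, v)\<close> have at most \<open>p - 1\<close> different ratios. If \<open>u\<close> and \<open>v\<close> range over
  primes, every ratio other than \<open>1\<close> comes from one pair, so \<open>M p\<close> is at least about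
  \<open>\<pi>(p)\<^sup>2 / p\<close> by the Cauchy--Schwarz inequality; the theorem then follows from the prime number
  theorem.

  The prime number theorem can be avoided by a gain in the constant. Take all \<open>u = d q\<close> with \<open>q\<close> prime
  and \<open>d \<le> s(q)\<^sup>2\<close>, weighted by \<open>1 / s(q)\<close>, where \<open>s(q)\<close> is the largest \<open>j \<le> J\<close> with \<open>j\<^sup>2 q < p\<close>.
  A ratio \<open>(d a) / (e b)\<close> with primes \<open>a \<noteq> b\<close> now comes from at most
  \<open>min (s(a)\<^sup>2) (s(b)\<^sup>2) \<le> s(a) s(b)\<close> pairs, which therefore have total weight at most \<open>1\<close>, while the
  sum of all weights grows from \<open>\<pi>(p)\<close> to \<open>\<pi>(p) + \<pi>(p/4) + \<pi>(p/9) + \<dots>\<close>. This gains the factor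
  \<open>1 + 1/4 + \<dots> + 1/J\<^sup>2\<close>, which exceeds \<open>1 / ln 2\<close> for \<open>J = 10\<close>, so Chebyshev's bound
  \<open>\<pi>(x) \<ge> (ln 2 - o(1)) x / ln x\<close> is enough.
\<close>

section \<open>Chebyshev's lower bound for the number of primes\<close>

text \<open>Legendre's formula, cut off at \<open>r\<close> because higher powers of
  \<open>q\<close> exceed \<open>n\<close>. From \<open>n\<close> to \<open>Suc n\<close> the
  quotient by \<open>q ^ i\<close> grows by one exactly when \<open>q ^ i\<close> divides
  \<open>Suc n\<close>, which happens for \<open>multiplicity q (Suc n)\<close> indices.\<close>

lemma multiplicity_fact_eq_sum_div:
  fixes q n r :: nat
  assumes q: "prime q" and "n < q ^ Suc r"
  shows "multiplicity q (fact n) = (\<Sum>i=1..r. n div q ^ i)"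
  using assms(2)
proof (induction n)
  case 0
  then show ?case by simp
next
  case (Suc n)
  let ?m = "multiplicity q (Suc n)"
  have dvd_iff: "q ^ i dvd Suc n \<longleftrightarrow> i \<le> ?m" for i
    using q by (intro power_dvd_iff_le_multiplicity) auto
  have "q ^ ?m \<le> Suc n"
    by (intro dvd_imp_le multiplicity_dvd) auto
  with Suc.prems have "q ^ ?m < q ^ Suc r" by linarith
  then have m_le: "?m \<le> r"
    using q prime_gt_1_nat power_less_imp_less_exp by (metis less_Suc_eq_le)
  have "(\<Sum>i=1..r. Suc n div q ^ i) = (\<Sum>i=1..r. n div q ^ i + (if i \<le> ?m then 1 else 0))"
    by (intro sum.cong refl) (auto simp: div_Suc dvd_iff[symmetric] mod_eq_0_iff_dvd)
  also have "\<dots> = (\<Sum>i=1..r. n div q ^ i) + card {i \<in> {1..r}. i \<le> ?m}"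
    by (simp add: sum.distrib sum.If_cases Int_def conj_commute)
  also have "{i \<in> {1..r}. i \<le> ?m} = {1..?m}"
    using m_le by auto
  finally have "(\<Sum>i=1..r. Suc n div q ^ i) = multiplicity q (fact n) + ?m"
    using Suc by simp
  moreover have "multiplicity q (fact (Suc n)) = multiplicity q (Suc n) + multiplicity q (fact n)"
    unfolding fact_Suc of_nat_id using q
    by (intro prime_elem_multiplicity_mult_distrib) auto
  ultimately show ?case by simp
qed

text \<open>By Legendre's formula each \<open>i\<close> contributes
  \<open>(2 * n) div q ^ i - 2 * (n div q ^ i)\<close>, which is 0 or 1, and only \<open>i\<close>
  with \<open>q ^ i \<le> 2 * n\<close> occur.\<close>

lemma prime_power_multiplicity_central_binomial_le:
  fixes q n :: nat
  assumes q: "prime q" and n: "n > 0"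
  shows "q ^ multiplicity q ((2 * n) choose n) \<le> 2 * n"
proof -
  have q1: "q > 1" using q prime_gt_1_nat by blast
  obtain r where r: "q ^ r \<le> 2 * n" "2 * n < q ^ Suc r"
    using ex_power_ivl1[of q "2 * n"] q1 n by auto
  have "multiplicity q (fact n * fact n * ((2 * n) choose n)) = multiplicity q (fact (2 * n))"
    using binomial_fact_lemma[of n "2 * n"] by (simp add: mult_2)
  moreover have "multiplicity q (fact n * fact n * ((2 * n) choose n)) =
      2 * multiplicity q (fact n) + multiplicity q ((2 * n) choose n)"
    using q by (simp add: prime_elem_multiplicity_mult_distrib)
  ultimately have "2 * (\<Sum>i=1..r. n div q ^ i) + multiplicity q ((2 * n) choose n) =
      (\<Sum>i=1..r. (2 * n) div q ^ i)"
    using multiplicity_fact_eq_sum_div[OF q, of "2 * n" r]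
      multiplicity_fact_eq_sum_div[OF q, of n r] r by simp
  also have "\<dots> \<le> (\<Sum>i=1..r. 2 * (n div q ^ i) + 1)"
  proof (intro sum_mono)
    fix i
    have pos: "q ^ i > 0" using q1 by simp
    have "n < q ^ i * (n div q ^ i + 1)"
      using dividend_less_times_div[OF pos, of n] by (simp add: algebra_simps)
    then have "2 * n < (2 * (n div q ^ i) + 2) * q ^ i"
      by (simp add: algebra_simps)
    then have "(2 * n) div q ^ i < 2 * (n div q ^ i) + 2"
      using less_mult_imp_div_less by blast
    then show "(2 * n) div q ^ i \<le> 2 * (n div q ^ i) + 1" by simp
  qed
  also have "\<dots> = 2 * (\<Sum>i=1..r. n div q ^ i) + r"
    by (simp only: sum.distrib sum_distrib_left) simp
  finally have "multiplicity q ((2 * n) choose n) \<le> r" by simp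
  then have "q ^ multiplicity q ((2 * n) choose n) \<le> q ^ r"
    using q1 by (intro power_increasing) auto
  with r show ?thesis by simp
qed

lemma central_binomial_le_power_card_primes:
  assumes n: "n > 0"
  shows "(2 * n) choose n \<le> (2 * n) ^ card {q :: nat. prime q \<and> q \<le> 2 * n}"
proof -
  let ?C = "(2 * n) choose n"
  have "?C = (\<Prod>q\<in>prime_factors ?C. q ^ multiplicity q ?C)"
    by (intro prime_factorization_nat) simp
  also have "\<dots> \<le> (\<Prod>q\<in>prime_factors ?C. 2 * n)"
    using n by (intro prod_mono) (auto intro!: prime_power_multiplicity_central_binomial_le)
  also have "\<dots> = (2 * n) ^ card (prime_factors ?C)" by simp
  also have "\<dots> \<le> (2 * n) ^ card {q :: nat. prime q \<and> q \<le> 2 * n}"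
  proof (intro power_increasing card_mono)
    show "prime_factors ?C \<subseteq> {q. prime q \<and> q \<le> 2 * n}"
    proof
      fix q assume "q \<in> prime_factors ?C"
      then have q: "prime q" "multiplicity q ?C > 0"
        by (auto simp: prime_factors_multiplicity)
      have "q ^ 1 \<le> q ^ multiplicity q ?C"
        using q prime_gt_0_nat[of q] by (intro power_increasing) auto
      with prime_power_multiplicity_central_binomial_le[OF q(1) n] q(1)
      show "q \<in> {q. prime q \<and> q \<le> 2 * n}" by simp
    qed
  qed (use n in auto)
  finally show ?thesis .
qed

text \<open>Take logarithms in \<open>4 ^ n / (2 * n) \<le> (2 * n) choose n\<close> for
  \<open>n = x div 2\<close>; the \<open>- 1\<close> pays for odd \<open>x\<close>. The separate
  \<open>y\<close> lets \<open>ln p\<close> serve as common scale for all cutoffs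
  \<open>x \<le> p\<close>.\<close>

lemma card_primes_lower_bound:
  fixes x y :: nat
  assumes "x \<le> y" "y \<ge> 1"
  shows "real (card {q :: nat. prime q \<and> q \<le> x}) * ln (real y) \<ge> (real x - 1) * ln 2 - ln (real y)"
proof (cases "x \<le> 1")
  case True
  then have "(real x - 1) * ln 2 \<le> 0"
    by (simp add: mult_nonpos_nonneg)
  moreover have "0 \<le> ln (real y)" using assms by simp
  ultimately show ?thesis
    by (smt (verit) mult_nonneg_nonneg of_nat_0_le_iff)
next
  case False
  define n where "n = x div 2"
  have n: "n > 0" "2 * n \<le> x" "x \<le> 2 * n + 1" using False by (auto simp: n_def)
  let ?k = "card {q :: nat. prime q \<and> q \<le> 2 * n}"
  have "4 ^ n / (2 * real n) \<le> real ((2 * n) choose n)"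
    by (rule central_binomial_lower_bound[OF n(1)])
  also have "\<dots> \<le> real ((2 * n) ^ ?k)"
    using central_binomial_le_power_card_primes[OF n(1)] of_nat_le_iff by blast
  finally have "4 ^ n / (2 * real n) \<le> (2 * real n) ^ ?k" by simp
  then have "ln (4 ^ n / (2 * real n)) \<le> ln ((2 * real n) ^ ?k)"
    using n by (subst ln_le_cancel_iff) auto
  then have "real n * ln 4 - ln (2 * real n) \<le> real ?k * ln (2 * real n)"
    using n ln_realpow[of "2 * real n" ?k] ln_realpow[of 4 n]
    by (simp only: ln_div) (simp add: ln_div)
  moreover have "ln (4 :: real) = 2 * ln 2"
    using ln_realpow[of 2 2] by simp
  ultimately have "2 * real n * ln 2 - ln (2 * real n) \<le> real ?k * ln (2 * real n)" by simp
  moreover have "(real x - 1) * ln 2 \<le> 2 * real n * ln 2"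
    using n by (intro mult_right_mono) auto
  moreover have ln_le: "ln (2 * real n) \<le> ln (real y)"
    using n assms by (subst ln_le_cancel_iff) auto
  moreover have "real ?k * ln (2 * real n) \<le>
      real (card {q :: nat. prime q \<and> q \<le> x}) * ln (real y)"
  proof (intro mult_mono ln_le)
    have "?k \<le> card {q :: nat. prime q \<and> q \<le> x}"
      using n by (intro card_mono) auto
    then show "real ?k \<le> real (card {q :: nat. prime q \<and> q \<le> x})" by simp
  qed (use n in auto)
  ultimately show ?thesis by linarith
qed

section \<open>Congruences satisfied by integers with equal Fermat quotients\<close>

lemma fermat_theorem_int:
  fixes u :: int
  assumes p: "prime p" and u: "\<not> int p dvd u"
  shows "[u ^ (p - 1) = 1] (mod int p)"
proof -
  have p0: "p > 0" using p prime_gt_0_nat by blast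
  define a where "a = nat (u mod int p)"
  have a: "int a = u mod int p" using p0 by (simp add: a_def)
  have "\<not> p dvd a"
    using u a by (metis dvd_mod_iff dvd_refl int_dvd_int_iff)
  then have "[a ^ (p - 1) = 1] (mod p)" by (rule fermat_theorem[OF p])
  then have "[int a ^ (p - 1) = 1] (mod int p)"
    by (metis cong_int_iff of_nat_1 of_nat_power)
  moreover have "[int a ^ (p - 1) = u ^ (p - 1)] (mod int p)"
    unfolding a by (intro cong_pow) simp
  ultimately show ?thesis using cong_sym cong_trans by blast
qed

text \<open>By Fermat both powers minus 1 are exact multiples of \<open>p\<close>, so a congruence
  of the quotients modulo \<open>p\<close> gains one more factor \<open>p\<close>.\<close>

lemma fermat_quotient_eq_imp_cong:
  assumes p: "prime p" and u: "\<not> int p dvd u" and v: "\<not> int p dvd v"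
    and eq: "fermat_quotient p u = fermat_quotient p v"
  shows "[u ^ (p - 1) = v ^ (p - 1)] (mod (int p)\<^sup>2)"
proof -
  obtain a b where a: "u ^ (p - 1) - 1 = int p * a" and b: "v ^ (p - 1) - 1 = int p * b"
    using fermat_theorem_int[OF p u] fermat_theorem_int[OF p v]
    unfolding cong_iff_dvd_diff by (elim dvdE)
  have "int p \<noteq> 0" using p by auto
  then have "[a = b] (mod int p)"
    using eq u v by (simp only: fermat_quotient_def a b if_False) (simp add: Cong.cong_def)
  then have "int p dvd a - b" by (simp add: cong_iff_dvd_diff)
  then have "int p * int p dvd int p * (a - b)" by (intro mult_dvd_mono) auto
  also have "int p * (a - b) = u ^ (p - 1) - v ^ (p - 1)"
    using a b by (simp add: algebra_simps)
  finally show ?thesis by (simp add: cong_iff_dvd_diff power2_eq_square)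
qed

text \<open>In the factorisation of \<open>x ^ p - y ^ p\<close> by \<open>x - y\<close>, the
  cofactor has \<open>p\<close> terms, all congruent to \<open>x ^ (p - 1)\<close>; so
  \<open>p\<close> divides both factors.\<close>

lemma cong_power_mod_square:
  fixes x y :: int
  assumes p: "p > 0" and xy: "[x = y] (mod int p)"
  shows "[x ^ p = y ^ p] (mod (int p)\<^sup>2)"
proof -
  obtain n where n: "p = Suc n" using p gr0_implies_Suc by blast
  have "[(\<Sum>i<Suc n. x ^ i * y ^ (n - i)) = (\<Sum>i<Suc n. x ^ i * x ^ (n - i))] (mod int p)"
    using xy by (intro cong_sum cong_mult cong_pow cong_refl) (rule cong_sym)
  also have "(\<Sum>i<Suc n. x ^ i * x ^ (n - i)) = (\<Sum>i<Suc n. x ^ n)"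
    by (intro sum.cong refl) (simp flip: power_add)
  also have "\<dots> = int p * x ^ n" by (simp add: n)
  also have "[int p * x ^ n = 0] (mod int p)" by (simp add: cong_0_iff)
  finally have "int p dvd (\<Sum>i<Suc n. x ^ i * y ^ (n - i))" by (simp add: cong_0_iff)
  moreover have "int p dvd x - y" using xy by (simp add: cong_iff_dvd_diff)
  ultimately have "int p * int p dvd (x - y) * (\<Sum>i<Suc n. x ^ i * y ^ (n - i))"
    by (intro mult_dvd_mono)
  also have "\<dots> = x ^ p - y ^ p"
    unfolding n by (rule diff_power_eq_sum[symmetric])
  finally show ?thesis by (simp add: cong_iff_dvd_diff power2_eq_square)
qed

text \<open>The fraction-free form, for the ratio \<open>x / y\<close>, of the fact that a root of
  unity is determined by its residue modulo \<open>p\<close>: cancel the unit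
  \<open>x ^ (p - 1)\<close> from \<open>x ^ p\<close> and \<open>y ^ p\<close>.\<close>

lemma cong_mod_prime_imp_cong_mod_square:
  fixes x y :: int
  assumes p: "prime p" and x: "\<not> int p dvd x" and xy: "[x = y] (mod int p)"
    and pow: "[x ^ (p - 1) = y ^ (p - 1)] (mod (int p)\<^sup>2)"
  shows "[x = y] (mod (int p)\<^sup>2)"
proof -
  have p0: "p > 0" using p prime_gt_0_nat by blast
  have "[x * x ^ (p - 1) = y * y ^ (p - 1)] (mod (int p)\<^sup>2)"
    using cong_power_mod_square[OF p0 xy] p0 by (simp add: power_eq_if)
  also have "[y * y ^ (p - 1) = y * x ^ (p - 1)] (mod (int p)\<^sup>2)"
    using pow by (intro cong_mult cong_refl) (rule cong_sym)
  finally have "[x * x ^ (p - 1) = y * x ^ (p - 1)] (mod (int p)\<^sup>2)" .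
  moreover have "coprime (x ^ (p - 1)) ((int p)\<^sup>2)"
    using p x prime_imp_coprime[of "int p" x] by (simp add: coprime_commute)
  ultimately show ?thesis by (simp add: cong_mult_rcancel)
qed

text \<open>The cross products have congruent \<open>(p - 1)\<close>-st powers modulo the square of
  \<open>p\<close>, so their congruence lifts to that modulus; both lie below it.\<close>

lemma fermat_quotient_pairs_cross_eq:
  fixes u v u' v' :: nat
  assumes p: "prime p"
    and range: "u \<in> {0<..<p}" "v \<in> {0<..<p}" "u' \<in> {0<..<p}" "v' \<in> {0<..<p}"
    and eq: "fermat_quotient p (int u) = fermat_quotient p (int v)"
      "fermat_quotient p (int u') = fermat_quotient p (int v')"
    and cong: "[int u * int v' = int u' * int v] (mod int p)"
  shows "u * v' = u' * v"
proof -
  have nd: "\<not> int p dvd int w" if "w \<in> {0<..<p}" for w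
    using that by (auto dest: nat_dvd_not_less)
  have "prime (int p)" using p by simp
  then have "\<not> int p dvd int u * int v'"
    using nd[OF range(1)] nd[OF range(4)] prime_dvd_mult_iff by blast
  moreover have "[(int u * int v') ^ (p - 1) = (int u' * int v) ^ (p - 1)] (mod (int p)\<^sup>2)"
    using cong_mult[OF fermat_quotient_eq_imp_cong[OF p nd[OF range(1)] nd[OF range(2)] eq(1)]
        cong_sym[OF fermat_quotient_eq_imp_cong[OF p nd[OF range(3)] nd[OF range(4)] eq(2)]]]
    by (simp add: power_mult_distrib mult.commute)
  ultimately have "[int u * int v' = int u' * int v] (mod (int p)\<^sup>2)"
    using cong_mod_prime_imp_cong_mod_square[OF p _ cong] by blast
  then have "[u * v' = u' * v] (mod p\<^sup>2)"
    by (simp flip: cong_int_iff)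
  moreover have "u * v' < p\<^sup>2" "u' * v < p\<^sup>2"
    using range by (auto simp: power2_eq_square intro!: mult_strict_mono)
  ultimately show ?thesis using cong_less_modulus_unique_nat by blast
qed

section \<open>Counting collisions\<close>

text \<open>Cauchy--Schwarz over the values of \<open>g\<close>, applied to the fibre sums of
  \<open>f\<close>; the squares of the fibre sums expand into the colliding pairs.\<close>

lemma sum_squared_le_card_image_mult_collisions:
  fixes f :: "'a \<Rightarrow> real"
  assumes I: "finite I"
  shows "(\<Sum>x\<in>I. f x)\<^sup>2 \<le>
    real (card (g ` I)) * (\<Sum>(x, y)\<in>{(x, y). x \<in> I \<and> y \<in> I \<and> g x = g y}. f x * f y)"
proof -
  define h where "h c = (\<Sum>x | x \<in> I \<and> g x = c. f x)" for c
  have "(\<Sum>x\<in>I. f x) = (\<Sum>c\<in>g ` I. h c)"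
    unfolding h_def using I by (intro sum.group[symmetric]) auto
  also have "\<dots>\<^sup>2 \<le> (\<Sum>c\<in>g ` I. (h c)\<^sup>2) * card (g ` I)"
    by (rule sum_squared_le_sum_of_squares)
  also have "(\<Sum>c\<in>g ` I. (h c)\<^sup>2) = (\<Sum>c\<in>g ` I. \<Sum>x | x \<in> I \<and> g x = c. f x * h (g x))"
    by (intro sum.cong refl) (simp add: power2_eq_square h_def sum_distrib_right)
  also have "\<dots> = (\<Sum>x\<in>I. f x * h (g x))"
    using I by (intro sum.group) auto
  also have "\<dots> = (\<Sum>x\<in>I. \<Sum>y | y \<in> I \<and> g y = g x. f x * f y)"
    by (simp add: h_def sum_distrib_left)
  also have "\<dots> = (\<Sum>(x, y)\<in>(SIGMA x:I. {y \<in> I. g y = g x}). f x * f y)"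
    using I by (intro sum.Sigma) auto
  also have "(SIGMA x:I. {y \<in> I. g y = g x}) = {(x, y). x \<in> I \<and> y \<in> I \<and> g x = g y}"
    by auto
  finally show ?thesis by (simp add: mult.commute)
qed

text \<open>The multipliers are too small to absorb \<open>a\<close> or \<open>b\<close>, so
  \<open>a\<close> must divide \<open>a'\<close> and \<open>b\<close> must divide \<open>b'\<close>;
  then \<open>a * b\<close> cancels.\<close>

lemma cross_eq_prime_multiples:
  fixes a b a' b' d e d' e' :: nat
  assumes "prime a" "prime b" "prime a'" "prime b'" "a \<noteq> b"
    and "d \<in> {0<..<b}" "e \<in> {0<..<a}" "d' \<in> {0<..<a}" "e' \<in> {0<..<b}"
    and eq: "(d * a) * (e' * b') = (d' * a') * (e * b)"
  shows "a' = a \<and> b' = b \<and> d * e' = d' * e"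
proof -
  have ndvd: "\<not> q dvd k" if "k \<in> {0<..<q}" for q k :: nat
    using that by (auto dest: nat_dvd_not_less)
  have "a dvd (d' * a') * (e * b)" by (simp flip: eq)
  then have "a dvd a'"
    using assms(1,2,5) ndvd[OF assms(7)] ndvd[OF assms(8)]
    by (auto simp: prime_dvd_mult_iff primes_dvd_imp_eq)
  then have a: "a' = a" using assms(1,3) primes_dvd_imp_eq by metis
  have "b dvd (d * a) * (e' * b')" by (simp add: eq)
  then have "b dvd b'"
    using assms(1,2,5) ndvd[OF assms(6)] ndvd[OF assms(9)]
    by (auto simp: prime_dvd_mult_iff dest: primes_dvd_imp_eq)
  then have b: "b' = b" using assms(2,4) primes_dvd_imp_eq by metis
  have "(d * e') * (a * b) = (d' * e) * (a * b)"
    using eq by (simp add: a b mult_ac)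
  then show ?thesis using a b assms by (simp add: prime_gt_0_nat)
qed

text \<open>Each coordinate determines the other, so the count is at most both
  \<open>m\<^sup>2\<close> and \<open>n\<^sup>2\<close>, hence at most their geometric mean.\<close>

lemma card_proportional_pairs_le:
  fixes m n d\<^sub>0 e\<^sub>0 :: nat
  assumes "d\<^sub>0 > 0" "e\<^sub>0 > 0"
  shows "card {(d, e). d \<in> {1..m\<^sup>2} \<and> e \<in> {1..n\<^sup>2} \<and> d\<^sub>0 * e = d * e\<^sub>0} \<le> m * n"
proof -
  let ?A = "{(d, e). d \<in> {1..m\<^sup>2} \<and> e \<in> {1..n\<^sup>2} \<and> d\<^sub>0 * e = d * e\<^sub>0}"
  have inj: "inj_on fst ?A" "inj_on snd ?A"
    using assms by (auto simp: inj_on_def) (metis mult_cancel1 less_not_refl)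
  have "fst ` ?A \<subseteq> {1..m\<^sup>2}" "snd ` ?A \<subseteq> {1..n\<^sup>2}" by auto
  then have "card ?A \<le> card {1..m\<^sup>2}" "card ?A \<le> card {1..n\<^sup>2}"
    using card_inj_on_le[OF inj(1)] card_inj_on_le[OF inj(2)] by blast+
  then have "card ?A * card ?A \<le> m\<^sup>2 * n\<^sup>2" by (intro mult_le_mono) auto
  then have "(card ?A)\<^sup>2 \<le> (m * n)\<^sup>2" by (simp add: power2_eq_square mult_ac)
  then show ?thesis by (rule power2_le_imp_le) simp
qed

lemma sum_squared_le_M_mult:
  fixes p J :: nat and P :: "nat set" and s :: "nat \<Rightarrow> nat"
  assumes p: "prime p" and P: "finite P"
    and prime: "\<And>q. q \<in> P \<Longrightarrow> prime q" and large: "\<And>q. q \<in> P \<Longrightarrow> J\<^sup>2 < q"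
    and s: "\<And>q. q \<in> P \<Longrightarrow> 1 \<le> s q" "\<And>q. q \<in> P \<Longrightarrow> s q \<le> J"
    and small: "\<And>q. q \<in> P \<Longrightarrow> (s q)\<^sup>2 * q < p"
  shows "(\<Sum>q\<in>P. real (s q))\<^sup>2 \<le> real (M p) * (real p + real J * (\<Sum>q\<in>P. real (s q)))"
proof -
  define I where "I = (SIGMA q:P. {1..(s q)\<^sup>2})"
  define u :: "nat \<times> nat \<Rightarrow> nat" where "u = (\<lambda>(q, d). d * q)"
  \<comment> \<open>With \<open>(s q)\<^sup>2\<close> multipliers of weight \<open>1 / s q\<close>,
    each prime \<open>q\<close> carries total weight \<open>s q\<close>.\<close>
  define f :: "nat \<times> nat \<Rightarrow> real" where "f = (\<lambda>(q, d). 1 / real (s q))"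
  define g where "g x = fermat_quotient p (int (u x))" for x
  have finI: "finite I" using P by (simp add: I_def)
  have s0: "real (s q) > 0" if "q \<in> P" for q using s(1)[OF that] by simp
  have u_range: "u x \<in> {0<..<p}" if "x \<in> I" for x
  proof -
    obtain q d where x: "x = (q, d)" by force
    with that have q: "q \<in> P" and d: "1 \<le> d" "d \<le> (s q)\<^sup>2" by (auto simp: I_def)
    have "d * q \<le> (s q)\<^sup>2 * q" using d by simp
    with small[OF q] have "d * q < p" by (rule le_less_trans[rotated])
    with d prime_gt_0_nat[OF prime[OF q]] show ?thesis by (simp add: x u_def)
  qed
  \<comment> \<open>Multipliers must lie below every prime of \<open>P\<close>, not only their own,
    for \<open>cross_eq_prime_multiples\<close> to apply.\<close>
  have d_bound: "d \<in> {0<..<b}" if "(a, d) \<in> I" "b \<in> P" for a b d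
  proof -
    have "1 \<le> d" "d \<le> (s a)\<^sup>2" "a \<in> P" using that by (auto simp: I_def)
    moreover have "(s a)\<^sup>2 \<le> J\<^sup>2" using s(2)[OF \<open>a \<in> P\<close>] by (intro power_mono) auto
    ultimately have "0 < d" "d < b" using large[OF \<open>b \<in> P\<close>] by linarith+
    then show ?thesis by simp
  qed

  have sum_f: "(\<Sum>x\<in>I. f x) = (\<Sum>q\<in>P. real (s q))"
  proof -
    have "(\<Sum>x\<in>I. f x) = (\<Sum>q\<in>P. \<Sum>d\<in>{1..(s q)\<^sup>2}. 1 / real (s q))"
      unfolding I_def f_def using P by (intro sum.Sigma[symmetric]) auto
    also have "\<dots> = (\<Sum>q\<in>P. real (s q))"
      using s0 by (intro sum.cong refl) (simp add: power2_eq_square)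
    finally show ?thesis .
  qed

  define Z where "Z = {(x, y). x \<in> I \<and> y \<in> I \<and> g x = g y}"
  \<comment> \<open>Pairs over one prime have ratios \<open>d / e\<close> that may recur for many
    primes, so they are bounded separately.\<close>
  define D where "D = {(x, y) \<in> Z. fst x = fst y}"
  define R where "R = {(x, y) \<in> Z. fst x \<noteq> fst y}"
  \<comment> \<open>The ratio \<open>u x / u y\<close> as a residue modulo \<open>p\<close>, by
    which the pairs in \<open>R\<close> are grouped.\<close>
  define \<phi> where "\<phi> = (\<lambda>(x, y). (int (u x) * modular_inverse (int p) (int (u y))) mod int p)"
  have finZ: "finite Z"
    by (rule finite_subset[of _ "I \<times> I"]) (use finI in \<open>auto simp: Z_def\<close>)
  then have finD: "finite D" and finR: "finite R"
    by (auto simp: D_def R_def intro: finite_subset[of _ Z])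

  have diag: "(\<Sum>(x, y)\<in>D. f x * f y) \<le> real J * (\<Sum>q\<in>P. real (s q))"
  proof -
    define T where "T = (SIGMA q:P. {1..(s q)\<^sup>2} \<times> {1..(s q)\<^sup>2})"
    define h :: "nat \<times> nat \<times> nat \<Rightarrow> (nat \<times> nat) \<times> (nat \<times> nat)"
      where "h = (\<lambda>(q, d, e). ((q, d), (q, e)))"
    have "(\<Sum>(x, y)\<in>D. f x * f y) \<le> (\<Sum>(x, y)\<in>h ` T. f x * f y)"
    proof (rule sum_mono2)
      show "D \<subseteq> h ` T"
      proof
        fix z assume z: "z \<in> D"
        obtain a d b e where zz: "z = ((a, d), (b, e))" by (metis surj_pair)
        with z have "(a, d, e) \<in> T" "z = h (a, d, e)"
          by (auto simp: D_def Z_def I_def T_def h_def)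
        then show "z \<in> h ` T" by blast
      qed
    qed (use P in \<open>auto simp: T_def f_def\<close>)
    also have "\<dots> = (\<Sum>(q, z)\<in>T. 1 / real (s q) * (1 / real (s q)))"
      by (subst sum.reindex) (auto simp: inj_on_def h_def f_def case_prod_unfold)
    also have "\<dots> = (\<Sum>q\<in>P. \<Sum>z\<in>{1..(s q)\<^sup>2} \<times> {1..(s q)\<^sup>2}. 1 / real (s q) * (1 / real (s q)))"
      unfolding T_def using P by (intro sum.Sigma[symmetric]) auto
    also have "\<dots> = (\<Sum>q\<in>P. real (s q) * real (s q))"
      using s0 by (intro sum.cong refl) (simp add: power2_eq_square)
    also have "\<dots> \<le> (\<Sum>q\<in>P. real J * real (s q))"
      using s(2) by (intro sum_mono mult_right_mono) auto
    finally show ?thesis by (simp add: sum_distrib_left)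
  qed

  have fibre: "(\<Sum>(x, y) | (x, y) \<in> R \<and> \<phi> (x, y) = r. f x * f y) \<le> 1" for r
  proof (cases "\<exists>z\<in>R. \<phi> z = r")
    case False
    then have "{(x, y). (x, y) \<in> R \<and> \<phi> (x, y) = r} = {}" by auto
    then show ?thesis by (simp only: sum.empty)
  next
    \<comment> \<open>One pair of the fibre fixes the primes \<open>a\<close>, \<open>b\<close> and
      the proportion of the multipliers for all others. At most \<open>s a * s b\<close> pairs
      remain, each of weight \<open>1 / (s a * s b)\<close>.\<close>
    case True
    then obtain a d\<^sub>0 b e\<^sub>0 where z0: "((a, d\<^sub>0), (b, e\<^sub>0)) \<in> R" "\<phi> ((a, d\<^sub>0), (b, e\<^sub>0)) = r"
      by (metis surj_pair)
    have ab: "(a, d\<^sub>0) \<in> I" "(b, e\<^sub>0) \<in> I" "g (a, d\<^sub>0) = g (b, e\<^sub>0)" "a \<noteq> b"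
      using z0(1) by (auto simp: R_def Z_def)
    then have abP: "a \<in> P" "b \<in> P" by (auto simp: I_def)
    define A where "A = {(d, e). d \<in> {1..(s a)\<^sup>2} \<and> e \<in> {1..(s b)\<^sup>2} \<and> d\<^sub>0 * e = d * e\<^sub>0}"
    define h :: "nat \<times> nat \<Rightarrow> (nat \<times> nat) \<times> (nat \<times> nat)"
      where "h = (\<lambda>(d, e). ((a, d), (b, e)))"
    have finA: "finite A"
      by (rule finite_subset[of _ "{1..(s a)\<^sup>2} \<times> {1..(s b)\<^sup>2}"]) (auto simp: A_def)
    have sub: "{(x, y). (x, y) \<in> R \<and> \<phi> (x, y) = r} \<subseteq> h ` A"
    proof
      fix z assume z: "z \<in> {(x, y). (x, y) \<in> R \<and> \<phi> (x, y) = r}"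
      obtain a' d b' e where zz: "z = ((a', d), (b', e))" by (metis surj_pair)
      have ab': "(a', d) \<in> I" "(b', e) \<in> I" "g (a', d) = g (b', e)" "\<phi> ((a', d), (b', e)) = r"
        using z zz by (auto simp: R_def Z_def)
      then have abP': "a' \<in> P" "b' \<in> P" by (auto simp: I_def)
      let ?u = "int (u (a, d\<^sub>0))" and ?v = "int (u (b, e\<^sub>0))"
      let ?u' = "int (u (a', d))" and ?v' = "int (u (b', e))"
      let ?inv = "modular_inverse (int p)"
      have inv: "[?inv (int w) * int w = 1] (mod int p)" if "w \<in> {0<..<p}" for w
      proof (rule cong_modular_inverse2)
        have "\<not> p dvd w" using that by (auto dest: nat_dvd_not_less)
        then show "coprime (int w) (int p)"
          using prime_imp_coprime[OF p, of w] by (simp add: coprime_commute)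
      qed
      have "[?u * ?inv ?v = ?u' * ?inv ?v'] (mod int p)"
        using z0(2) ab'(4) unfolding \<phi>_def Cong.cong_def prod.case by metis
      \<comment> \<open>Multiplying by both denominators turns equal ratios into congruent cross
        products.\<close>
      then have "[(?u * ?inv ?v) * (?v * ?v') = (?u' * ?inv ?v') * (?v * ?v')] (mod int p)"
        by (rule cong_mult[OF _ cong_refl])
      moreover have "(?u * ?inv ?v) * (?v * ?v') = (?u * ?v') * (?inv ?v * ?v)"
        "(?u' * ?inv ?v') * (?v * ?v') = (?u' * ?v) * (?inv ?v' * ?v')"
        by (simp_all only: mult_ac)
      moreover note cong_mult[OF cong_refl[of "?u * ?v'"] inv[OF u_range[OF ab(2)]]]
        cong_mult[OF cong_refl[of "?u' * ?v"] inv[OF u_range[OF ab'(2)]]]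
      ultimately have "[?u * ?v' = ?u' * ?v] (mod int p)"
        unfolding Cong.cong_def mult_1_right by metis
      then have "u (a, d\<^sub>0) * u (b', e) = u (a', d) * u (b, e\<^sub>0)"
        using ab(3) ab'(3) unfolding g_def
        by (intro fermat_quotient_pairs_cross_eq[OF p] u_range ab(1,2) ab'(1,2))
      then have "(d\<^sub>0 * a) * (e * b') = (d * a') * (e\<^sub>0 * b)"
        by (simp add: u_def)
      then have "a' = a \<and> b' = b \<and> d\<^sub>0 * e = d * e\<^sub>0"
        by (rule cross_eq_prime_multiples[OF prime[OF abP(1)] prime[OF abP(2)]
              prime[OF abP'(1)] prime[OF abP'(2)] ab(4) d_bound[OF ab(1) abP(2)]
              d_bound[OF ab(2) abP(1)] d_bound[OF ab'(1) abP(1)] d_bound[OF ab'(2) abP(2)]])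
      then have "(d, e) \<in> A" "z = h (d, e)"
        using ab' by (auto simp: A_def h_def zz I_def)
      then show "z \<in> h ` A" by blast
    qed
    have "(\<Sum>(x, y) | (x, y) \<in> R \<and> \<phi> (x, y) = r. f x * f y) \<le> (\<Sum>(x, y)\<in>h ` A. f x * f y)"
      using finA by (intro sum_mono2 sub) (auto simp: f_def)
    also have "\<dots> = (\<Sum>z\<in>A. 1 / real (s a) * (1 / real (s b)))"
      by (subst sum.reindex) (auto simp: inj_on_def h_def f_def case_prod_unfold)
    also have "\<dots> = real (card A) / real (s a * s b)" by simp
    also have "card A \<le> s a * s b"
      unfolding A_def using ab by (intro card_proportional_pairs_le) (auto simp: I_def)
    then have "real (card A) / real (s a * s b) \<le> 1"
      using s0[OF abP(1)] s0[OF abP(2)] by (simp del: of_nat_mult)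
    finally show ?thesis .
  qed
  have off: "(\<Sum>(x, y)\<in>R. f x * f y) \<le> real p"
  proof -
    have "p > 0" using p prime_gt_0_nat by blast
    then have "\<phi> ` R \<subseteq> {0..<int p}" by (auto simp: \<phi>_def)
    then have "(\<Sum>(x, y)\<in>R. f x * f y) =
        (\<Sum>r\<in>{0..<int p}. \<Sum>(x, y) | (x, y) \<in> R \<and> \<phi> (x, y) = r. f x * f y)"
      using sum.group[of R "{0..<int p}" \<phi> "\<lambda>(x, y). f x * f y"] finR
      by (simp add: case_prod_unfold)
    also have "\<dots> \<le> (\<Sum>r\<in>{0..<int p}. 1)" by (intro sum_mono fibre)
    finally show ?thesis by simp
  qed

  have "(\<Sum>(x, y)\<in>Z. f x * f y) = (\<Sum>(x, y)\<in>D \<union> R. f x * f y)"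
    by (intro sum.cong) (auto simp: D_def R_def)
  also have "\<dots> = (\<Sum>(x, y)\<in>D. f x * f y) + (\<Sum>(x, y)\<in>R. f x * f y)"
    using finD finR by (intro sum.union_disjoint) (auto simp: D_def R_def)
  finally have coll: "(\<Sum>(x, y)\<in>Z. f x * f y) \<le> real p + real J * (\<Sum>q\<in>P. real (s q))"
    using diag off by linarith
  have "g ` I \<subseteq> fermat_quotient p ` {0..int p - 1}"
    using u_range by (auto simp: g_def)
  then have "card (g ` I) \<le> M p"
    unfolding M_def by (intro card_mono) auto
  have "(\<Sum>q\<in>P. real (s q))\<^sup>2 \<le> real (card (g ` I)) * (\<Sum>(x, y)\<in>Z. f x * f y)"
    unfolding Z_def using sum_squared_le_card_image_mult_collisions[OF finI, of f g] sum_f by simp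
  also have "\<dots> \<le> real (M p) * (real p + real J * (\<Sum>q\<in>P. real (s q)))"
    using \<open>card (g ` I) \<le> M p\<close> coll
    by (intro mult_mono) (auto intro!: sum_nonneg simp: f_def)
  finally show ?thesis .
qed

section \<open>The total weight of the primes and the choice of constants\<close>

lemma exists_weight_bound:
  fixes p J :: nat
  assumes p: "prime p"
  obtains F :: real
  where "F\<^sup>2 \<le> real (M p) * (real p + real J * F)"
    and "F * ln (real p) \<ge>
      real p * (ln 2 * (\<Sum>j=1..J. 1 / (real j)\<^sup>2)) - real J * (3 + (1 + (real J)\<^sup>2) * ln (real p))"
proof -
  define P where "P = {q. prime q \<and> J\<^sup>2 < q \<and> q < p}"
  \<comment> \<open>\<open>S q\<close> is an initial segment of the positive integers, so its
    cardinality is the \<open>s(q)\<close> of the weights; as a cardinality it can be counted by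
    double summation.\<close>
  define S where "S q = {j \<in> {1..J}. j\<^sup>2 * q < p}" for q
  define L where "L = ln (real p)"
  have finP: "finite P" by (simp add: P_def)
  have finS: "finite (S q)" for q by (simp add: S_def)
  have p1: "p > 1" using p prime_gt_1_nat by blast
  have L0: "L \<ge> 0" using p1 by (simp add: L_def)
  show ?thesis
  proof (cases "J = 0")
    case True
    then show ?thesis by (intro that[of 0]) auto
  next
    case False
    define F where "F = (\<Sum>q\<in>P. real (card (S q)))"
    have S1: "1 \<in> S q" if "q \<in> P" for q using that False by (simp add: S_def P_def)
    have "F\<^sup>2 \<le> real (M p) * (real p + real J * F)"
      unfolding F_def
    proof (rule sum_squared_le_M_mult[OF p finP])
      fix q assume q: "q \<in> P"
      show "prime q" "J\<^sup>2 < q" using q by (auto simp: P_def)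
      show "1 \<le> card (S q)" using S1[OF q] finS by (metis One_nat_def Suc_leI card_gt_0_iff empty_iff)
      have "S q \<subseteq> {1..J}" by (auto simp: S_def)
      then show "card (S q) \<le> J" using card_mono[of "{1..J}"] by simp
      have ne: "S q \<noteq> {}" using S1[OF q] by blast
      have "S q \<subseteq> {1..Max (S q)}" using finS by (auto simp: S_def)
      then have "card (S q) \<le> Max (S q)" using card_mono[of "{1..Max (S q)}"] by simp
      then have "(card (S q))\<^sup>2 * q \<le> (Max (S q))\<^sup>2 * q" by (intro mult_right_mono power_mono) auto
      also have "\<dots> < p" using Max_in[OF finS ne] by (auto simp: S_def)
      finally show "(card (S q))\<^sup>2 * q < p" .
    qed
    moreover have "F * L \<ge> real p * (ln 2 * (\<Sum>j=1..J. 1 / (real j)\<^sup>2)) - real J * (3 + (1 + (real J)\<^sup>2) * L)"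
    proof -
      \<comment> \<open>Exchanging the sums turns the total weight into a sum over \<open>j\<close>
        of numbers of primes in \<open>P\<close> below \<open>p / j\<^sup>2\<close>.\<close>
      have "F = (\<Sum>q\<in>P. \<Sum>j=1..J. of_bool (j\<^sup>2 * q < p))"
        unfolding F_def S_def by (intro sum.cong refl) (simp add: Int_def)
      also have "\<dots> = (\<Sum>j=1..J. \<Sum>q\<in>P. of_bool (j\<^sup>2 * q < p))" by (rule sum.swap)
      also have "\<dots> = (\<Sum>j=1..J. real (card {q \<in> P. j\<^sup>2 * q < p}))"
        using finP by (intro sum.cong refl) (simp add: Int_def)
      finally have F: "F = (\<Sum>j=1..J. real (card {q \<in> P. j\<^sup>2 * q < p}))" .
      \<comment> \<open>The error combines at most \<open>3 * ln 2\<close> from rounding, one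
        \<open>L\<close> from Chebyshev's bound and \<open>(real J)\<^sup>2 * L\<close> for the
        small primes left out of \<open>P\<close>.\<close>
      have "real p * (ln 2 * (1 / (real j)\<^sup>2)) - (3 + (1 + (real J)\<^sup>2) * L) \<le>
          real (card {q \<in> P. j\<^sup>2 * q < p}) * L" if j: "j \<in> {1..J}" for j
      proof -
        \<comment> \<open>Dividing \<open>p - 1\<close> rather than \<open>p\<close> encodes the
          strict inequality \<open>j\<^sup>2 * q < p\<close>.\<close>
        define x where "x = (p - 1) div j\<^sup>2"
        have j0: "j\<^sup>2 > 0" using j by simp
        have xle: "x \<le> p" by (simp add: x_def) (meson diff_le_self div_le_dividend order_trans)
        have le_x: "q \<le> x \<longleftrightarrow> j\<^sup>2 * q < p" for q
          using p1 j0 by (auto simp: x_def less_eq_div_iff_mult_less_eq mult.commute)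
        have "{q. prime q \<and> q \<le> x} \<subseteq> {q \<in> P. j\<^sup>2 * q < p} \<union> {1..J\<^sup>2}"
        proof
          fix q assume "q \<in> {q. prime q \<and> q \<le> x}"
          then have q: "prime q" "j\<^sup>2 * q < p" using le_x by auto
          have "1 * q \<le> j\<^sup>2 * q" using j0 by (intro mult_le_mono1) simp
          then have "q < p" using q(2) by linarith
          with q prime_gt_0_nat[OF q(1)] show "q \<in> {q \<in> P. j\<^sup>2 * q < p} \<union> {1..J\<^sup>2}"
            by (auto simp: P_def)
        qed
        then have "card {q. prime q \<and> q \<le> x} \<le> card ({q \<in> P. j\<^sup>2 * q < p} \<union> {1..J\<^sup>2})"
          using finP by (intro card_mono) auto
        also have "\<dots> \<le> card {q \<in> P. j\<^sup>2 * q < p} + card {1..J\<^sup>2}" by (rule card_Un_le)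
        finally have "real (card {q. prime q \<and> q \<le> x}) \<le> real (card {q \<in> P. j\<^sup>2 * q < p}) + (real J)\<^sup>2"
          by (simp flip: of_nat_add of_nat_power)
        then have "real (card {q. prime q \<and> q \<le> x}) * L \<le>
            (real (card {q \<in> P. j\<^sup>2 * q < p}) + (real J)\<^sup>2) * L"
          using L0 by (rule mult_right_mono)
        moreover have "(real x - 1) * ln 2 - L \<le> real (card {q. prime q \<and> q \<le> x}) * L"
          unfolding L_def using xle p1 by (intro card_primes_lower_bound) auto
        moreover have "real p / (real j)\<^sup>2 \<le> real x + 2"
        proof -
          have "p - 1 < j\<^sup>2 * (x + 1)"
            using dividend_less_times_div[OF j0, of "p - 1"] by (simp add: x_def algebra_simps)
          then have "p \<le> j\<^sup>2 * (x + 1)" by simp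
          then have "real p \<le> real (j\<^sup>2 * (x + 1))" by (simp only: of_nat_le_iff)
          then have "real p / (real j)\<^sup>2 \<le> real x + 1"
            using j by (simp add: divide_le_eq algebra_simps)
          then show ?thesis by simp
        qed
        then have "real p / (real j)\<^sup>2 * ln 2 \<le> (real x + 2) * ln 2"
          by (intro mult_right_mono) auto
        moreover have "ln (2 :: real) \<le> 1" using ln_le_minus_one[of 2] by simp
        ultimately show ?thesis by (simp add: algebra_simps)
      qed
      then have "(\<Sum>j=1..J. real p * (ln 2 * (1 / (real j)\<^sup>2)) - (3 + (1 + (real J)\<^sup>2) * L)) \<le> F * L"
        unfolding F sum_distrib_right by (intro sum_mono)
      then show ?thesis by (simp add: sum_subtractf sum_distrib_left)
    qed
    ultimately show ?thesis unfolding L_def by (rule that)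
  qed
qed

theorem theorem10:
  shows "\<forall>\<epsilon>>0. \<exists>N. \<forall>p. prime p \<and> p \<ge> N \<longrightarrow>
           real (M p) \<ge> (1 - \<epsilon>) * real p / (ln (real p))^2"
proof -
  \<comment> \<open>The last condition makes the error of \<open>exists_weight_bound\<close> for
    \<open>J = 10\<close>, where \<open>1 + J\<^sup>2 = 101\<close>, at most \<open>x / 100\<close>;
    \<open>ln x \<ge> 400\<close> makes the term \<open>10 * F\<close> negligible against
    \<open>x\<close>.\<close>
  have "eventually (\<lambda>x::real. x > 1 \<and> ln x \<ge> 400 \<and> 10 * (3 + 101 * ln x) \<le> x / 100) at_top"
    by (intro eventually_conj; real_asymp)
  then obtain B :: real where
    B: "\<And>x. x \<ge> B \<Longrightarrow> x > 1 \<and> ln x \<ge> 400 \<and> 10 * (3 + 101 * ln x) \<le> x / 100"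
    by (auto simp: eventually_at_top_linorder)
  \<comment> \<open>The gain over Chebyshev's constant leaves room to spare, so the bound holds
    without any \<open>\<epsilon>\<close>.\<close>
  have bound: "real p / (ln (real p))\<^sup>2 \<le> real (M p)" if p: "prime p" and "p \<ge> nat \<lceil>B\<rceil>" for p
  proof -
    define x where "x = real p"
    define L where "L = ln x"
    have "x \<ge> B" using that by (simp add: x_def)
    with B[of x] have x: "x > 1" "L \<ge> 400" "10 * (3 + 101 * L) \<le> x / 100"
      by (auto simp: L_def)
    obtain F where F: "F\<^sup>2 \<le> real (M p) * (x + 10 * F)"
      "x * (ln 2 * (\<Sum>j=1..10. 1 / (real j)\<^sup>2)) - 10 * (3 + 101 * L) \<le> F * L"
      using exists_weight_bound[OF p, of 10] by (auto simp: x_def L_def)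
    \<comment> \<open>The sum is about 1.5498, and two thirds of it about 1.033. Of the 3 percent
      gained, one goes to the error term.\<close>
    have "103 / 100 \<le> 2 / 3 * (\<Sum>j=1..10. 1 / (real j)\<^sup>2)"
      by (simp add: numeral_eq_Suc)
    also have "\<dots> \<le> ln 2 * (\<Sum>j=1..10. 1 / (real j)\<^sup>2)"
      by (intro mult_right_mono ln2_ge_two_thirds sum_nonneg) auto
    finally have "x * (103 / 100) \<le> x * (ln 2 * (\<Sum>j=1..10. 1 / (real j)\<^sup>2))"
      using x by (intro mult_left_mono) auto
    with F(2) x have FL: "102 / 100 * x \<le> F * L" by linarith
    then have FL0: "F * L > 0" using x by linarith
    then have F0: "F > 0" using x by (simp add: zero_less_mult_iff)
    have "(102 / 100 * x)\<^sup>2 \<le> (F * L)\<^sup>2" using FL x by (intro power_mono) auto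
    moreover have "(102 / 100 * x)\<^sup>2 = 10404 / 10000 * (x * x)"
      by (simp add: power2_eq_square)
    \<comment> \<open>Here \<open>1.0404 * 0.97 > 1\<close>. The remaining 3 percent cover
      \<open>10 * (x * F)\<close>, which is at most \<open>10 / 400\<close> of
      \<open>(F * L)\<^sup>2\<close>.\<close>
    ultimately have main: "x * x \<le> (F * L)\<^sup>2 * (97 / 100)"
      using zero_le_power2[of "F * L"] by linarith
    have "x \<le> F * L" using FL x by linarith
    then have "x * F \<le> F * L * F" using F0 by (intro mult_right_mono) auto
    also have "\<dots> \<le> F * L * F * (L / 400)"
      using mult_left_mono[of 1 "L / 400" "F * L * F"] x FL0 F0 by simp
    also have "\<dots> = (F * L)\<^sup>2 / 400" by (simp add: power2_eq_square)
    finally have "x * F \<le> (F * L)\<^sup>2 / 400" .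
    moreover have "x * (x + 10 * F) = x * x + 10 * (x * F)" by (simp add: algebra_simps)
    ultimately have "x * (x + 10 * F) \<le> (F * L)\<^sup>2"
      using main zero_le_power2[of "F * L"] by linarith
    also have "\<dots> \<le> L\<^sup>2 * (real (M p) * (x + 10 * F))"
      using mult_left_mono[OF F(1), of "L\<^sup>2"] by (simp add: power_mult_distrib mult.commute)
    finally have "x * (x + 10 * F) \<le> L\<^sup>2 * real (M p) * (x + 10 * F)" by (simp add: mult_ac)
    then have "x \<le> L\<^sup>2 * real (M p)" using F0 x by simp
    then show ?thesis using x by (simp add: divide_le_eq mult.commute flip: x_def L_def)
  qed
  show ?thesis
  proof (intro allI impI)
    fix \<epsilon> :: real assume "\<epsilon> > 0"
    have "(1 - \<epsilon>) * real p / (ln (real p))\<^sup>2 \<le> real p / (ln (real p))\<^sup>2" for p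
      using \<open>\<epsilon> > 0\<close> by (intro divide_right_mono) (auto simp: algebra_simps)
    with bound show "\<exists>N. \<forall>p. prime p \<and> p \<ge> N \<longrightarrow>
        real (M p) \<ge> (1 - \<epsilon>) * real p / (ln (real p))^2"
      by (meson order_trans)
  qed
qed

end
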